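(* Let $n\ge1$ and let $\{J_1,J_2,J_3\}$ be the hypercomplex structure on the real Lie algebra underlying $\mathfrak{sl}(2n+1,\mathbb C)$ induced by the complex product structure $\{J,E\}$ of $\mathfrak{sl}(2n+1,\mathbb R)$ described in the context. There is no HKT metric on $\mathfrak{sl}(2n+1,\mathbb C)$ compatible with $\{J_1,J_2,J_3\}$.
   Context: Write elements of $\mathfrak{sl}(2n+1,\mathbb R)$ as $\begin{bmatrix}A&w\\ v^t&-\operatorname{tr}A\end{bmatrix}\leftrightarrow(A,v,w)$ with $A\in\mathfrak{gl}(2n,\mathbb R)$, $v,w\in\mathbb R^{2n}$. Let $J_0=\begin{bmatrix}0&-I_n\\ I_n&0\end{bmatrix}$, $E_0=\begin{bmatrix}I_n&0\\ 0&-I_n\end{bmatrix}$, and set $J(A,v,w)=(AJ_0,-J_0v,-J_0w)$, $E(A,v,w)=(AE_0,E_0v,-E_0w)$. Let $\mathfrak s_\pm$ be the $(\pm1)$-eigenspaces of $E$. On $\mathfrak{sl}(2n+1,\mathbb C)=\mathfrak{sl}(2n+1,\mathbb R)\oplus i\,\mathfrak{sl}(2n+1,\mathbb R)$, viewed as a real Lie algebra, define $J_1(x+iy)=Jx+iJy$; $J_2(x+iy)=i(x+iy)$ for $x,y\in\mathfrak s_+$ and $J_2(x+iy)=-i(x+iy)$ for $x,y\in\mathfrak s_-$ (extended additively); $J_3=J_1J_2$. This is a hypercomplex structure. An HKT metric on a real Lie algebra $\mathfrak g$ compatible with a hypercomplex structure $\{J_\alpha\}$ is a (positive definite) inner product $g$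 with $g(J_\alpha x,J_\alpha y)=g(x,y)$ for all $\alpha$, such that the quantity $$g([J_\alpha x,J_\alpha y],z)+g([J_\alpha y,J_\alpha z],x)+g([J_\alpha z,J_\alpha x],y)$$ is the same for $\alpha=1,2,3$, for all $x,y,z\in\mathfrak g$. *)

theory Defs
  imports "HOL-Analysis.Analysis"
begin

text \<open>
  The integer \<open>n \<ge> 1\<close> is rendered as \<open>CARD('n)\<close> for a finite index type \<open>'n\<close>: vectors in
  \<open>\<real>\<^sup>2\<^sup>n\<close> are indexed by \<open>'n + 'n\<close>, and matrices of size \<open>2n + 1\<close> by \<open>('n + 'n) + unit\<close>.
\<close>

type_synonym ('a, 'n) dmat = "'a ^ ('n + 'n) ^ ('n + 'n)"
type_synonym ('a, 'n) bmat = "'a ^ (('n + 'n) + unit) ^ (('n + 'n) + unit)"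

definition sl :: "('a::comm_ring_1 ^ 'm ^ 'm) set" where
  "sl = {X. trace X = 0}"

definition lie_bracket :: "'a::comm_ring_1 ^ 'm ^ 'm \<Rightarrow> 'a ^ 'm ^ 'm \<Rightarrow> 'a ^ 'm ^ 'm" where
  "lie_bracket X Y = X ** Y - Y ** X"

definition block_matrix ::
  "'a ^ 'p ^ 'p \<Rightarrow> 'a ^ 'q ^ 'p \<Rightarrow> 'a ^ 'p ^ 'q \<Rightarrow> 'a ^ 'q ^ 'q \<Rightarrow> 'a ^ ('p + 'q) ^ ('p + 'q)" where
  "block_matrix P Q R S = (\<chi> i j.
     case i of
       Inl a \<Rightarrow> (case j of Inl b \<Rightarrow> P $ a $ b | Inr b \<Rightarrow> Q $ a $ b)
     | Inr a \<Rightarrow> (case j of Inl b \<Rightarrow> R $ a $ b | Inr b \<Rightarrow> S $ a $ b))"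

definition J0 :: "(real, 'n::finite) dmat" where
  "J0 = block_matrix 0 (- mat 1) (mat 1) 0"

definition E0 :: "(real, 'n::finite) dmat" where
  "E0 = block_matrix (mat 1) 0 0 (- mat 1)"

text \<open>The identification \<open>(A, v, w) \<leftrightarrow> [A, w; v\<^sup>t, - tr A]\<close>.\<close>

definition sl_of :: "(real, 'n::finite) dmat \<Rightarrow> real ^ ('n + 'n) \<Rightarrow> real ^ ('n + 'n) \<Rightarrow> (real, 'n) bmat" where
  "sl_of A v w = block_matrix A (\<chi> i j. w $ i) (\<chi> i j. v $ j) (\<chi> i j. - trace A)"

definition part_A :: "(real, 'n::finite) bmat \<Rightarrow> (real, 'n) dmat" where
  "part_A X = (\<chi> i j. X $ Inl i $ Inl j)"

definition part_v :: "(real, 'n::finite) bmat \<Rightarrow> real ^ ('n + 'n)" where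
  "part_v X = (\<chi> j. X $ Inr () $ Inl j)"

definition part_w :: "(real, 'n::finite) bmat \<Rightarrow> real ^ ('n + 'n)" where
  "part_w X = (\<chi> i. X $ Inl i $ Inr ())"

definition cps_J :: "(real, 'n::finite) bmat \<Rightarrow> (real, 'n) bmat" where
  "cps_J X = sl_of (part_A X ** J0) (- (J0 *v part_v X)) (- (J0 *v part_w X))"

definition cps_E :: "(real, 'n::finite) bmat \<Rightarrow> (real, 'n) bmat" where
  "cps_E X = sl_of (part_A X ** E0) (E0 *v part_v X) (- (E0 *v part_w X))"

definition s_plus :: "(real, 'n::finite) bmat set" where
  "s_plus = {X \<in> sl. cps_E X = X}"

definition s_minus :: "(real, 'n::finite) bmat set" where
  "s_minus = {X \<in> sl. cps_E X = - X}"

definition proj_plus :: "(real, 'n::finite) bmat \<Rightarrow> (real, 'n) bmat" where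
  "proj_plus X = (1/2) *\<^sub>R (X + cps_E X)"

definition proj_minus :: "(real, 'n::finite) bmat \<Rightarrow> (real, 'n) bmat" where
  "proj_minus X = (1/2) *\<^sub>R (X - cps_E X)"

definition re_part :: "complex ^ 'm ^ 'm \<Rightarrow> real ^ 'm ^ 'm" where
  "re_part Z = map_matrix Re Z"

definition im_part :: "complex ^ 'm ^ 'm \<Rightarrow> real ^ 'm ^ 'm" where
  "im_part Z = map_matrix Im Z"

definition re_im :: "real ^ 'm ^ 'm \<Rightarrow> real ^ 'm ^ 'm \<Rightarrow> complex ^ 'm ^ 'm" where
  "re_im x y = (\<chi> i j. Complex (x $ i $ j) (y $ i $ j))"

definition times_i :: "complex ^ 'm ^ 'm \<Rightarrow> complex ^ 'm ^ 'm" where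
  "times_i Z = map_matrix ((*) \<i>) Z"

definition J1 :: "(complex, 'n::finite) bmat \<Rightarrow> (complex, 'n) bmat" where
  "J1 Z = re_im (cps_J (re_part Z)) (cps_J (im_part Z))"

text \<open>
  Multiplication by \<open>\<i>\<close> on \<open>s_plus \<oplus> \<i> s_plus\<close> and by \<open>-\<i>\<close> on \<open>s_minus \<oplus> \<i> s_minus\<close>; the lemmas
  \<open>J2_s_plus\<close>, \<open>J2_s_minus\<close>, \<open>J2_add\<close> and \<open>J2_unique\<close> below show that on \<open>sl\<close> this is the only
  additive map with these two properties.
\<close>

definition J2 :: "(complex, 'n::finite) bmat \<Rightarrow> (complex, 'n) bmat" where
  "J2 Z = times_i (re_im (proj_plus (re_part Z)) (proj_plus (im_part Z)))
        - times_i (re_im (proj_minus (re_part Z)) (proj_minus (im_part Z)))"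

definition J3 :: "(complex, 'n::finite) bmat \<Rightarrow> (complex, 'n) bmat" where
  "J3 Z = J1 (J2 Z)"

text \<open>
  The real Lie algebra is a real subspace \<open>L\<close> of an ambient space, with bracket \<open>br\<close>; the values of
  \<open>g\<close> outside \<open>L\<close> are irrelevant.
\<close>

definition inner_product_on :: "'v::real_vector set \<Rightarrow> ('v \<Rightarrow> 'v \<Rightarrow> real) \<Rightarrow> bool" where
  "inner_product_on L g \<longleftrightarrow>
     (\<forall>x\<in>L. \<forall>y\<in>L. g x y = g y x) \<and>
     (\<forall>x\<in>L. \<forall>y\<in>L. \<forall>z\<in>L. g (x + y) z = g x z + g y z) \<and>
     (\<forall>c. \<forall>x\<in>L. \<forall>y\<in>L. g (c *\<^sub>R x) y = c * g x y) \<and>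
     (\<forall>x\<in>L. x \<noteq> 0 \<longrightarrow> g x x > 0)"

definition hkt_cyclic_sum ::
  "('v \<Rightarrow> 'v \<Rightarrow> 'v) \<Rightarrow> ('v \<Rightarrow> 'v \<Rightarrow> real) \<Rightarrow> ('v \<Rightarrow> 'v) \<Rightarrow> 'v \<Rightarrow> 'v \<Rightarrow> 'v \<Rightarrow> real" where
  "hkt_cyclic_sum br g K x y z =
     g (br (K x) (K y)) z + g (br (K y) (K z)) x + g (br (K z) (K x)) y"

definition hkt_metric ::
  "'v::real_vector set \<Rightarrow> ('v \<Rightarrow> 'v \<Rightarrow> 'v) \<Rightarrow> ('v \<Rightarrow> 'v) \<Rightarrow> ('v \<Rightarrow> 'v) \<Rightarrow> ('v \<Rightarrow> 'v) \<Rightarrow>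
     ('v \<Rightarrow> 'v \<Rightarrow> real) \<Rightarrow> bool" where
  "hkt_metric L br K1 K2 K3 g \<longleftrightarrow>
     inner_product_on L g \<and>
     (\<forall>K\<in>{K1, K2, K3}. \<forall>x\<in>L. \<forall>y\<in>L. g (K x) (K y) = g x y) \<and>
     (\<forall>x\<in>L. \<forall>y\<in>L. \<forall>z\<in>L.
        hkt_cyclic_sum br g K1 x y z = hkt_cyclic_sum br g K2 x y z \<and>
        hkt_cyclic_sum br g K2 x y z = hkt_cyclic_sum br g K3 x y z)"

lemma sum_UNIV_sum:
  fixes f :: "'p::finite + 'q::finite \<Rightarrow> 'b::comm_monoid_add"
  shows "(\<Sum>i\<in>UNIV. f i) = (\<Sum>a\<in>UNIV. f (Inl a)) + (\<Sum>b\<in>UNIV. f (Inr b))"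
proof -
  have "(\<Sum>i\<in>UNIV. f i) = sum f (UNIV <+> UNIV)"
    by simp
  also have "\<dots> = (\<Sum>a\<in>UNIV. f (Inl a)) + (\<Sum>b\<in>UNIV. f (Inr b))"
    by (subst sum.Plus) simp_all
  finally show ?thesis .
qed

lemma trace_sl_of: "trace (sl_of A v w) = 0"
proof -
  have "trace (sl_of A v w) = (\<Sum>a\<in>UNIV. sl_of A v w $ Inl a $ Inl a) + sl_of A v w $ Inr () $ Inr ()"
    unfolding trace_def by (subst sum_UNIV_sum) (simp add: UNIV_unit)
  then show ?thesis
    by (simp add: sl_of_def block_matrix_def trace_def)
qed

lemma sl_of_in_sl: "sl_of A v w \<in> sl"
  by (simp add: sl_def trace_sl_of)

lemma parts_sl_of:
  "part_A (sl_of A v w) = A" "part_v (sl_of A v w) = v" "part_w (sl_of A v w) = w"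
  by (simp_all add: part_A_def part_v_def part_w_def sl_of_def block_matrix_def vec_eq_iff)

lemma sl_of_parts:
  assumes "X \<in> sl"
  shows "sl_of (part_A X) (part_v X) (part_w X) = X"
proof -
  have "trace X = trace (part_A X) + X $ Inr () $ Inr ()"
    unfolding trace_def part_A_def by (subst sum_UNIV_sum) (simp add: UNIV_unit)
  with assms have "X $ Inr () $ Inr () = - trace (part_A X)"
    by (simp add: sl_def)
  then show ?thesis
    by (auto simp: vec_eq_iff sl_of_def block_matrix_def part_A_def part_v_def part_w_def
        split: sum.splits)
qed

lemma sl_of_add: "sl_of (A + A') (v + v') (w + w') = sl_of A v w + sl_of A' v' w'"
  by (auto simp: vec_eq_iff sl_of_def block_matrix_def trace_add split: sum.splits)

lemma parts_add:
  "part_A (X + Y) = part_A X + part_A Y" "part_v (X + Y) = part_v X + part_v Y"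
  "part_w (X + Y) = part_w X + part_w Y"
  by (simp_all add: vec_eq_iff part_A_def part_v_def part_w_def)

lemma matrix_mult_add_right:
  fixes B :: "(real, 'n::finite) dmat"
  shows "(B + C) ** A = B ** A + C ** A"
  by (simp add: vec_eq_iff matrix_matrix_mult_def sum.distrib distrib_right)

lemma matrix_vector_mult_neg:
  fixes M :: "(real, 'n::finite) dmat"
  shows "M *v (- x) = - (M *v x)"
  using matrix_vector_mult_diff_distrib [of M 0 x] by simp

lemma cps_E_add: "cps_E (X + Y) = cps_E X + cps_E Y"
  unfolding cps_E_def
  by (simp add: parts_add matrix_mult_add_right matrix_vector_right_distrib flip: sl_of_add)

lemma cps_E_diff: "cps_E (X - Y) = cps_E X - cps_E Y"
  by (metis cps_E_add diff_add_cancel eq_diff_eq)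

lemma cps_E_half: "cps_E ((1/2) *\<^sub>R X) = (1/2) *\<^sub>R cps_E X"
proof -
  have "cps_E X = cps_E ((1/2) *\<^sub>R X) + cps_E ((1/2) *\<^sub>R X)"
    unfolding cps_E_add [symmetric] by (simp flip: scaleR_add_left)
  then show ?thesis
    by (simp add: scaleR_add_right flip: scaleR_add_left)
qed

lemma E0_nth: "E0 $ i $ j = (if i = j then (case i of Inl _ \<Rightarrow> 1 | Inr _ \<Rightarrow> - 1) else 0)"
  by (auto simp: E0_def block_matrix_def mat_def split: sum.splits)

lemma E0_sq: "E0 ** E0 = (mat 1 :: (real, 'n::finite) dmat)"
proof -
  have "(E0 ** E0) $ i $ j = (mat 1 :: (real, 'n) dmat) $ i $ j" for i j :: "'n + 'n"
  proof -
    have "(E0 ** E0) $ i $ j = (\<Sum>k\<in>UNIV. if i = k then E0 $ i $ i * E0 $ i $ j else 0)"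
      unfolding matrix_matrix_mult_def vec_lambda_beta
      by (rule sum.cong) (simp_all add: E0_nth)
    also have "\<dots> = (mat 1 :: (real, 'n) dmat) $ i $ j"
      by (simp add: E0_nth mat_def split: sum.splits)
    finally show ?thesis .
  qed
  then show ?thesis
    by (simp add: vec_eq_iff)
qed

lemma cps_E_cps_E:
  assumes "X \<in> sl"
  shows "cps_E (cps_E X) = X"
  using sl_of_parts [OF assms]
  by (simp add: cps_E_def parts_sl_of E0_sq matrix_vector_mul_assoc
      matrix_vector_mult_neg flip: matrix_mul_assoc)

lemma cps_E_in_sl: "cps_E X \<in> sl"
  by (simp add: cps_E_def sl_of_in_sl)

lemma sl_real_subspace: "subspace (sl :: (real ^ 'm ^ 'm) set)"
  by (auto simp: subspace_def sl_def trace_def sum.distrib simp flip: sum_distrib_left)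

lemma proj_plus_in:
  assumes "X \<in> sl"
  shows "proj_plus X \<in> s_plus"
  using assms cps_E_in_sl [of X]
  by (auto simp: proj_plus_def s_plus_def cps_E_half cps_E_add cps_E_cps_E add.commute
      intro!: subspace_mul [OF sl_real_subspace] subspace_add [OF sl_real_subspace])

lemma proj_minus_in:
  assumes "X \<in> sl"
  shows "proj_minus X \<in> s_minus"
proof -
  have "cps_E (proj_minus X) = - proj_minus X"
    using assms by (simp add: proj_minus_def cps_E_half cps_E_diff cps_E_cps_E
        flip: scaleR_minus_right)
  then show ?thesis
    using assms cps_E_in_sl [of X]
    by (auto simp: proj_minus_def s_minus_def
        intro!: subspace_mul [OF sl_real_subspace] subspace_diff [OF sl_real_subspace])
qed

lemma proj_plus_add_proj_minus: "proj_plus X + proj_minus X = X"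
  by (simp add: proj_plus_def proj_minus_def scaleR_add_right scaleR_diff_right
      flip: scaleR_add_left)

lemma proj_s_plus: "x \<in> s_plus \<Longrightarrow> proj_plus x = x" "x \<in> s_plus \<Longrightarrow> proj_minus x = 0"
  by (simp_all add: s_plus_def proj_plus_def proj_minus_def scaleR_add_right flip: scaleR_add_left)

lemma proj_s_minus: "x \<in> s_minus \<Longrightarrow> proj_plus x = 0" "x \<in> s_minus \<Longrightarrow> proj_minus x = x"
  by (simp_all add: s_minus_def proj_plus_def proj_minus_def scaleR_add_right flip: scaleR_add_left)

lemma proj_add:
  "proj_plus (X + Y) = proj_plus X + proj_plus Y" "proj_minus (X + Y) = proj_minus X + proj_minus Y"
  by (simp_all add: proj_plus_def proj_minus_def cps_E_add algebra_simps)

lemma parts_re_im: "re_part (re_im x y) = x" "im_part (re_im x y) = y"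
  by (simp_all add: re_part_def im_part_def re_im_def vec_eq_iff)

lemma re_im_parts: "re_im (re_part Z) (im_part Z) = Z"
  by (simp add: re_part_def im_part_def re_im_def vec_eq_iff)

lemma parts_complex_add:
  "re_part (Z + W) = re_part Z + re_part W" "im_part (Z + W) = im_part Z + im_part W"
  by (simp_all add: re_part_def im_part_def vec_eq_iff)

lemma re_im_add: "re_im (x + x') (y + y') = re_im x y + re_im x' y'"
  by (simp add: re_im_def vec_eq_iff complex_eq_iff)

lemma re_im_zero: "re_im 0 0 = 0"
  by (simp add: re_im_def vec_eq_iff complex_eq_iff)

lemma times_i_zero: "times_i 0 = 0"
  by (simp add: times_i_def vec_eq_iff)

lemma times_i_add: "times_i (Z + W) = times_i Z + times_i W"
  by (simp add: times_i_def vec_eq_iff algebra_simps)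

lemma re_im_in_sl_iff: "re_im x y \<in> sl \<longleftrightarrow> x \<in> sl \<and> y \<in> sl"
  by (simp add: sl_def trace_def re_im_def complex_eq_iff)

lemma J2_s_plus:
  assumes "x \<in> s_plus" "y \<in> s_plus"
  shows "J2 (re_im x y) = times_i (re_im x y)"
  using assms by (simp add: J2_def parts_re_im proj_s_plus re_im_zero times_i_zero)

lemma J2_s_minus:
  assumes "x \<in> s_minus" "y \<in> s_minus"
  shows "J2 (re_im x y) = - times_i (re_im x y)"
  using assms by (simp add: J2_def parts_re_im proj_s_minus re_im_zero times_i_zero)

lemma J2_add: "J2 (Z + W) = J2 Z + J2 W"
  by (simp add: J2_def parts_complex_add proj_add re_im_add times_i_add)

lemma J2_unique:
  fixes F :: "(complex, 'n::finite) bmat \<Rightarrow> (complex, 'n) bmat"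
  assumes "\<And>x y. x \<in> s_plus \<Longrightarrow> y \<in> s_plus \<Longrightarrow> F (re_im x y) = times_i (re_im x y)"
    and "\<And>x y. x \<in> s_minus \<Longrightarrow> y \<in> s_minus \<Longrightarrow> F (re_im x y) = - times_i (re_im x y)"
    and add: "\<And>Z W. Z \<in> sl \<Longrightarrow> W \<in> sl \<Longrightarrow> F (Z + W) = F Z + F W"
    and "Z \<in> sl"
  shows "F Z = J2 Z"
proof -
  let ?p = "re_im (proj_plus (re_part Z)) (proj_plus (im_part Z))"
  let ?m = "re_im (proj_minus (re_part Z)) (proj_minus (im_part Z))"
  have sl: "re_part Z \<in> sl" "im_part Z \<in> sl"
    using \<open>Z \<in> sl\<close> re_im_in_sl_iff [of "re_part Z" "im_part Z"] by (simp_all add: re_im_parts)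
  have Z: "Z = ?p + ?m"
    by (simp add: proj_plus_add_proj_minus re_im_parts flip: re_im_add)
  have "?p \<in> sl" "?m \<in> sl"
    using proj_plus_in [OF sl(1)] proj_plus_in [OF sl(2)] proj_minus_in [OF sl(1)]
      proj_minus_in [OF sl(2)]
    by (simp_all add: re_im_in_sl_iff s_plus_def s_minus_def)
  then have "F Z = F ?p + F ?m"
    using add Z by metis
  also have "\<dots> = J2 Z"
    using assms(1) [OF proj_plus_in [OF sl(1)] proj_plus_in [OF sl(2)]]
      assms(2) [OF proj_minus_in [OF sl(1)] proj_minus_in [OF sl(2)]]
    by (simp add: J2_def)
  finally show ?thesis .
qed

end

theory Submission
  imports Defs
begin

text \<open>
  Number three of the basis vectors as \<open>1 = Inl (Inl a)\<close>, \<open>2 = Inl (Inr a)\<close>, \<open>3 = Inr ()\<close>, and let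
  \<open>x = e\<^sub>1\<^sub>2\<close>, \<open>y = e\<^sub>2\<^sub>3\<close>, \<open>z = e\<^sub>1\<^sub>3\<close>. Then \<open>J\<^sub>1 x = e\<^sub>1\<^sub>1 - e\<^sub>3\<^sub>3\<close>, \<open>J\<^sub>1 y = z\<close>, \<open>J\<^sub>1 z = - y\<close>, so the
  cyclic sum of \<open>J\<^sub>1\<close> at \<open>(x, y, z)\<close> is \<open>2 g(z, z) + g(y, y)\<close>; whereas \<open>J\<^sub>2\<close> multiplies \<open>x\<close>, \<open>y\<close>, \<open>z\<close>
  by \<open>-\<i>\<close>, \<open>\<i>\<close>, \<open>-\<i>\<close>, so its cyclic sum is \<open>g(z, z)\<close>. Equality forces \<open>g(z, z) + g(y, y) = 0\<close>.
\<close>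

text \<open>The entry \<open>c\<close> is a parameter so that multiples by \<open>- 1\<close> or
  \<open>\<i>\<close> are again matrix units and \<open>matrix_unit_mult\<close> covers their
  products.\<close>

definition matrix_unit :: "'p \<Rightarrow> 'q \<Rightarrow> 'a::zero \<Rightarrow> 'a ^ 'q ^ 'p" where
  "matrix_unit i j c = (\<chi> k l. if k = i \<and> l = j then c else 0)"

lemma matrix_unit_nth [simp]:
  "matrix_unit i j c $ k $ l = (if k = i \<and> l = j then c else 0)"
  by (simp add: matrix_unit_def)

lemma matrix_unit_eq_0_iff [simp]: "matrix_unit i j c = 0 \<longleftrightarrow> c = 0"
  by (auto simp: vec_eq_iff)

lemma matrix_unit_minus: "matrix_unit i j (- c) = - matrix_unit i j (c :: 'a::ring)"
  by (simp add: vec_eq_iff)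

lemma matrix_unit_mult_nth:
  fixes M :: "'a::semiring_1 ^ 'r ^ 'q"
  shows "(matrix_unit i j c ** M) $ k $ l = (if k = i then c * M $ j $ l else 0)"
proof -
  have "(matrix_unit i j c ** M) $ k $ l =
      (\<Sum>q\<in>UNIV. if q = j then (if k = i then c * M $ q $ l else 0) else 0)"
    unfolding matrix_matrix_mult_def vec_lambda_beta by (rule sum.cong) auto
  then show ?thesis
    by simp
qed

lemma matrix_unit_mult:
  fixes c d :: "'a::semiring_1"
  shows "matrix_unit i j c ** matrix_unit k l d = (if j = k then matrix_unit i l (c * d) else 0)"
  by (auto simp: vec_eq_iff matrix_unit_mult_nth)

lemma matrix_mult_diff_distrib:
  fixes A :: "'a::ring_1 ^ 'q ^ 'p"
  shows "A ** (B - C) = A ** B - A ** C"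
  by (simp add: vec_eq_iff matrix_matrix_mult_def right_diff_distrib sum_subtractf)

lemma matrix_diff_mult_distrib:
  fixes A B :: "'a::ring_1 ^ 'q ^ 'p"
  shows "(A - B) ** C = A ** C - B ** C"
  by (simp add: vec_eq_iff matrix_matrix_mult_def left_diff_distrib sum_subtractf)

lemma trace_matrix_unit: "trace (matrix_unit i j c) = (if i = j then c else 0)"
proof -
  have "trace (matrix_unit i j c) = (\<Sum>k\<in>UNIV. if k = i then (if i = j then c else 0) else 0)"
    unfolding trace_def by (rule sum.cong) auto
  then show ?thesis
    by simp
qed

lemma matrix_unit_in_sl: "i \<noteq> j \<Longrightarrow> matrix_unit i j c \<in> sl"
  by (simp add: sl_def trace_matrix_unit)

lemma J0_nth:
  "J0 $ Inl a $ Inl b = 0" "J0 $ Inl a $ Inr b = (if a = b then - 1 else 0)"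
  "J0 $ Inr a $ Inl b = (if a = b then 1 else 0)" "J0 $ Inr a $ Inr b = 0"
  by (simp_all add: J0_def block_matrix_def mat_def)

lemma parts_matrix_unit_A:
  "part_A (matrix_unit (Inl i) (Inl j) c) = matrix_unit i j c"
  "part_v (matrix_unit (Inl i) (Inl j) c) = 0"
  "part_w (matrix_unit (Inl i) (Inl j) c) = 0"
  by (simp_all add: vec_eq_iff part_A_def part_v_def part_w_def)

lemma parts_matrix_unit_w:
  "part_A (matrix_unit (Inl i) (Inr u) c) = 0"
  "part_v (matrix_unit (Inl i) (Inr u) c) = 0"
  "part_w (matrix_unit (Inl i) (Inr u) c) = axis i c"
  by (simp_all add: vec_eq_iff part_A_def part_v_def part_w_def axis_def)

lemma sl_of_w: "sl_of 0 0 (axis i c) = matrix_unit (Inl i) (Inr ()) c"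
  by (auto simp: vec_eq_iff sl_of_def block_matrix_def axis_def trace_def split: sum.splits)

lemma cps_J_0: "cps_J 0 = 0"
  by (auto simp: vec_eq_iff cps_J_def part_A_def part_v_def part_w_def sl_of_def block_matrix_def
      matrix_matrix_mult_def matrix_vector_mult_def trace_def split: sum.splits)

lemma cps_E_0: "cps_E 0 = 0"
  using cps_E_diff [of 0 0] by simp

text \<open>The product sees only row \<open>Inr a\<close> of \<open>J0\<close>, whose sole nonzero
  entry is 1 in column \<open>Inl a\<close>.\<close>

lemma matrix_unit_J0: "matrix_unit i (Inr a) c ** J0 = matrix_unit i (Inl a) c"
proof -
  have "(matrix_unit i (Inr a) c ** J0) $ k $ l = matrix_unit i (Inl a) c $ k $ l" for k l
    by (cases l) (auto simp: matrix_unit_mult_nth J0_nth)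
  then show ?thesis
    by (simp add: vec_eq_iff)
qed

text \<open>Multiplication by \<open>J0\<close> moves the entry onto the diagonal. The block then
  has trace \<open>c\<close>, and the corner \<open>- trace A\<close> in \<open>sl_of\<close>
  supplies the second term.\<close>

lemma cps_J_A:
  "cps_J (matrix_unit (Inl (Inl a)) (Inl (Inr a)) c) =
     matrix_unit (Inl (Inl a)) (Inl (Inl a)) c - matrix_unit (Inr ()) (Inr ()) c"
  unfolding cps_J_def parts_matrix_unit_A matrix_unit_J0
  by (auto simp: vec_eq_iff sl_of_def block_matrix_def trace_matrix_unit split: sum.splits)

lemma matrix_vector_mult_axis_nth:
  "(M *v axis i c) $ k = M $ k $ i * (c :: 'a::semiring_1)"
proof -
  have "(M *v axis i c) $ k = (\<Sum>q\<in>UNIV. if q = i then M $ k $ q * c else 0)"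
    unfolding matrix_vector_mult_def vec_lambda_beta by (rule sum.cong) (auto simp: axis_def)
  then show ?thesis
    by simp
qed

lemma axis_nth_if: "axis i c $ k = (if k = i then c else 0)"
  by (simp add: axis_def)

lemma J0_axis:
  "J0 *v axis (Inl a) c = axis (Inr a) c"
  "J0 *v axis (Inr a) c = - axis (Inl a) c"
proof -
  have "(J0 *v axis (Inl a) c) $ k = axis (Inr a) c $ k" for k
    by (cases k) (simp_all add: matrix_vector_mult_axis_nth J0_nth axis_nth_if)
  then show "J0 *v axis (Inl a) c = axis (Inr a) c"
    by (simp add: vec_eq_iff)
  have "(J0 *v axis (Inr a) c) $ k = - axis (Inl a) c $ k" for k
    by (cases k) (simp_all add: matrix_vector_mult_axis_nth J0_nth axis_nth_if)
  then show "J0 *v axis (Inr a) c = - axis (Inl a) c"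
    by (simp add: vec_eq_iff)
qed

lemma axis_minus: "- axis i c = axis i (- c :: 'a::ring)"
  by (simp add: vec_eq_iff axis_def)

text \<open>The last column transforms by \<open>- J0\<close>, a quarter turn in the plane of the
  coordinates \<open>Inl a\<close> and \<open>Inr a\<close>; hence the asymmetric signs.\<close>

lemma cps_J_w:
  "cps_J (matrix_unit (Inl (Inl a)) (Inr ()) c) = - matrix_unit (Inl (Inr a)) (Inr ()) c"
  "cps_J (matrix_unit (Inl (Inr a)) (Inr ()) c) = matrix_unit (Inl (Inl a)) (Inr ()) c"
  by (simp_all add: cps_J_def parts_matrix_unit_w J0_axis axis_minus sl_of_w flip: matrix_unit_minus)

text \<open>Right multiplication by \<open>E0\<close> scales columns, and column
  \<open>Inr a\<close> has sign -1. The block stays off-diagonal, so no corner entry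
  appears.\<close>

lemma cps_E_A:
  "cps_E (matrix_unit (Inl (Inl a)) (Inl (Inr a)) c) = - matrix_unit (Inl (Inl a)) (Inl (Inr a)) c"
proof -
  have E0: "matrix_unit (Inl a) (Inr a) c ** E0 = matrix_unit (Inl a) (Inr a) (- c)"
    by (simp add: vec_eq_iff matrix_unit_mult_nth E0_nth)
  show ?thesis
    unfolding cps_E_def parts_matrix_unit_A E0
    by (auto simp: vec_eq_iff sl_of_def block_matrix_def trace_matrix_unit split: sum.splits)
qed

lemma E0_axis:
  "E0 *v axis (Inl a) c = axis (Inl a) c" "E0 *v axis (Inr a) c = axis (Inr a) (- c)"
  by (simp_all add: vec_eq_iff matrix_vector_mult_axis_nth E0_nth axis_nth_if)

text \<open>The last column transforms by \<open>- E0\<close>, so the signs are opposite to those of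
  \<open>E0\<close>.\<close>

lemma cps_E_w:
  "cps_E (matrix_unit (Inl (Inl a)) (Inr ()) c) = - matrix_unit (Inl (Inl a)) (Inr ()) c"
  "cps_E (matrix_unit (Inl (Inr a)) (Inr ()) c) = matrix_unit (Inl (Inr a)) (Inr ()) c"
  by (simp_all add: cps_E_def parts_matrix_unit_w E0_axis axis_minus sl_of_w flip: matrix_unit_minus)

text \<open>The entry 1 is complex on the left and real on the right. This is what lets the real
  maps \<open>cps_J\<close> and \<open>cps_E\<close> be applied to complex matrix units.\<close>

lemma matrix_unit_re_im: "matrix_unit i j 1 = re_im (matrix_unit i j 1) 0"
  by (simp add: vec_eq_iff re_im_def complex_eq_iff)

lemma times_i_matrix_unit: "times_i (matrix_unit i j c) = matrix_unit i j (\<i> * c)"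
  by (simp add: times_i_def vec_eq_iff)

lemma J1_real_matrix_unit: "J1 (matrix_unit i j 1) = re_im (cps_J (matrix_unit i j 1)) 0"
  by (subst matrix_unit_re_im) (simp add: J1_def parts_re_im cps_J_0)

lemma J2_real_matrix_unit:
  assumes "i \<noteq> j"
  shows "cps_E (matrix_unit i j 1) = matrix_unit i j 1 \<Longrightarrow>
      J2 (matrix_unit i j 1) = matrix_unit i j \<i>"
    and "cps_E (matrix_unit i j 1) = - matrix_unit i j 1 \<Longrightarrow>
      J2 (matrix_unit i j 1) = matrix_unit i j (- \<i>)"
proof -
  \<comment> \<open>Zero is the imaginary part of a real matrix, and \<open>J2_s_plus\<close> and
    \<open>J2_s_minus\<close> need both parts in the same eigenspace.\<close>
  have zero: "0 \<in> s_plus" "0 \<in> s_minus"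
    by (simp_all add: s_plus_def s_minus_def sl_def trace_def cps_E_0)
  show "J2 (matrix_unit i j 1) = matrix_unit i j \<i>"
    if "cps_E (matrix_unit i j 1) = matrix_unit i j 1"
  proof -
    have "matrix_unit i j 1 \<in> s_plus"
      using that assms by (simp add: s_plus_def matrix_unit_in_sl)
    from J2_s_plus [OF this zero(1)] show ?thesis
      by (simp add: times_i_matrix_unit flip: matrix_unit_re_im)
  qed
  show "J2 (matrix_unit i j 1) = matrix_unit i j (- \<i>)"
    if "cps_E (matrix_unit i j 1) = - matrix_unit i j 1"
  proof -
    have "matrix_unit i j 1 \<in> s_minus"
      using that assms by (simp add: s_minus_def matrix_unit_in_sl)
    from J2_s_minus [OF this zero(2)] show ?thesis
      by (simp add: times_i_matrix_unit matrix_unit_minus flip: matrix_unit_re_im)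
  qed
qed

lemma J1_matrix_unit:
  "J1 (matrix_unit (Inl (Inl a)) (Inl (Inr a)) 1) =
     matrix_unit (Inl (Inl a)) (Inl (Inl a)) 1 - matrix_unit (Inr ()) (Inr ()) 1"
  "J1 (matrix_unit (Inl (Inr a)) (Inr ()) 1) = matrix_unit (Inl (Inl a)) (Inr ()) 1"
  "J1 (matrix_unit (Inl (Inl a)) (Inr ()) 1) = matrix_unit (Inl (Inr a)) (Inr ()) (- 1)"
  unfolding J1_real_matrix_unit cps_J_A cps_J_w
  by (auto simp: vec_eq_iff re_im_def complex_eq_iff)

lemma J2_matrix_unit:
  "J2 (matrix_unit (Inl (Inl a)) (Inl (Inr a)) 1) = matrix_unit (Inl (Inl a)) (Inl (Inr a)) (- \<i>)"
  "J2 (matrix_unit (Inl (Inr a)) (Inr ()) 1) = matrix_unit (Inl (Inr a)) (Inr ()) \<i>"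
  "J2 (matrix_unit (Inl (Inl a)) (Inr ()) 1) = matrix_unit (Inl (Inl a)) (Inr ()) (- \<i>)"
  by (simp_all add: J2_real_matrix_unit cps_E_A cps_E_w)

theorem proposition4p5:
  shows "\<not> (\<exists>g. hkt_metric (sl :: (complex, 'n::finite) bmat set) lie_bracket J1 J2 J3 g)"
proof
  assume "\<exists>g. hkt_metric (sl :: (complex, 'n::finite) bmat set) lie_bracket J1 J2 J3 g"
  then obtain g where g: "hkt_metric (sl :: (complex, 'n) bmat set) lie_bracket J1 J2 J3 g" ..
  \<comment> \<open>Types are nonempty, so such an index exists; this is the condition n \<ge>
    1.\<close>
  fix a :: 'n
  define x :: "(complex, 'n) bmat" where "x = matrix_unit (Inl (Inl a)) (Inl (Inr a)) 1"
  define y :: "(complex, 'n) bmat" where "y = matrix_unit (Inl (Inr a)) (Inr ()) 1"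
  define z :: "(complex, 'n) bmat" where "z = matrix_unit (Inl (Inl a)) (Inr ()) 1"
  have sl: "x \<in> sl" "y \<in> sl" "z \<in> sl"
    by (simp_all add: x_def y_def z_def matrix_unit_in_sl)
  have g_scale: "g (c *\<^sub>R u) v = c * g u v" if "u \<in> sl" "v \<in> sl" for c u v
    using g that by (simp add: hkt_metric_def inner_product_on_def)
  have g_0: "g 0 v = 0" if "v \<in> sl" for v
    using g_scale [OF that that, of 0] by simp
  have g_pos: "g v v > 0" if "v \<in> sl" "v \<noteq> 0" for v
    using g that by (simp add: hkt_metric_def inner_product_on_def)
  \<comment> \<open>The corner term of \<open>J1 x\<close> matters twice: it contributes the second
    copy of \<open>z\<close> in the first bracket, and it alone produces \<open>y\<close> in the
    third.\<close>
  have J1_brackets: "lie_bracket (J1 x) (J1 y) = 2 *\<^sub>R z" "lie_bracket (J1 y) (J1 z) = 0"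
      "lie_bracket (J1 z) (J1 x) = y"
    by (simp_all add: x_def y_def z_def lie_bracket_def J1_matrix_unit matrix_unit_mult
        matrix_mult_diff_distrib matrix_diff_mult_distrib scaleR_2)
      (simp add: matrix_unit_minus)
  \<comment> \<open>The factors \<open>- \<i>\<close> and \<open>\<i>\<close> multiply to 1, leaving
    the bracket of \<open>x\<close> and \<open>y\<close>. In the other two brackets all products of
    matrix units vanish.\<close>
  have J2_brackets: "lie_bracket (J2 x) (J2 y) = z" "lie_bracket (J2 y) (J2 z) = 0"
      "lie_bracket (J2 z) (J2 x) = 0"
    by (simp_all add: x_def y_def z_def lie_bracket_def J2_matrix_unit matrix_unit_mult)
  have "hkt_cyclic_sum lie_bracket g J1 x y z = hkt_cyclic_sum lie_bracket g J2 x y z"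
    using g sl by (simp add: hkt_metric_def)
  then have "g z z + g y y = 0"
    using sl by (simp add: hkt_cyclic_sum_def J1_brackets J2_brackets g_scale g_0)
  moreover have "g z z > 0" "g y y > 0"
    using sl by (auto intro!: g_pos simp: y_def z_def)
  ultimately show False
    by simp
qed

end
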